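(* For every integer $m\ge 8$, $$\gamma_{\mathrm{sdR}}(P_{m,3})=\begin{cases} m & \text{if } m \text{ is even},\\ m+1 & \text{if } m\text{ is odd}.\end{cases}$$
   Context: For $m\ge3$ and $k\in\mathbb{Z}_m\setminus\{0\}$, the generalized Petersen graph $P_{m,k}$ has vertex set $\{u_i,v_i:i\in\mathbb{Z}_m\}$ and edge set $\{u_iu_{i+1}, v_iv_{i+k}, u_iv_i: i\in\mathbb{Z}_m\}$. $N(u)$ is the open neighborhood, $N[u]=N(u)\cup\{u\}$; for $f:V\to\{-1,1,2,3\}$, $V_i=f^{-1}(i)$, $f(S)=\sum_{s\in S}f(s)$. A signed double Roman domination function (SDRDF) is $f:V\to\{-1,1,2,3\}$ with: (1) every $u\in V_{-1}$ has a neighbor in $V_3$ or at least two distinct neighbors in $V_2$; (2) every $u\in V_1$ has a neighbor in $V_2\cup V_3$; (3) $f(N[u])\ge1$ for all $u$. $\gamma_{\mathrm{sdR}}(G)$ is the minimum of $f(V)$ over all SDRDFs on $G$. *)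

theory Defs
  imports Main
begin

text \<open>A finite simple graph is given by its vertex set and its set of edges, each edge being
  the two-element set of its endpoints.\<close>

definition simple_graph :: "'a set \<Rightarrow> 'a set set \<Rightarrow> bool" where
  "simple_graph V E \<longleftrightarrow> finite V \<and> (\<forall>e\<in>E. e \<subseteq> V \<and> card e = 2)"

definition open_nbhd :: "'a set set \<Rightarrow> 'a \<Rightarrow> 'a set" where
  "open_nbhd E u = {w. {u, w} \<in> E}"

definition closed_nbhd :: "'a set set \<Rightarrow> 'a \<Rightarrow> 'a set" where
  "closed_nbhd E u = insert u (open_nbhd E u)"

text \<open>Only the values of \<open>f\<close> on \<open>V\<close> matter below; \<open>f\<close> is unconstrained elsewhere.\<close>

definition is_sdrdf :: "'a set \<Rightarrow> 'a set set \<Rightarrow> ('a \<Rightarrow> int) \<Rightarrow> bool" where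
  "is_sdrdf V E f \<longleftrightarrow>
     (\<forall>u\<in>V. f u \<in> {-1, 1, 2, 3}) \<and>
     (\<forall>u\<in>V. f u = -1 \<longrightarrow>
        (\<exists>w\<in>open_nbhd E u. f w = 3) \<or>
        (\<exists>w\<in>open_nbhd E u. \<exists>w'\<in>open_nbhd E u. w \<noteq> w' \<and> f w = 2 \<and> f w' = 2)) \<and>
     (\<forall>u\<in>V. f u = 1 \<longrightarrow> (\<exists>w\<in>open_nbhd E u. f w = 2 \<or> f w = 3)) \<and>
     (\<forall>u\<in>V. sum f (closed_nbhd E u) \<ge> 1)"

definition sdrdf_weights :: "'a set \<Rightarrow> 'a set set \<Rightarrow> int set" where
  "sdrdf_weights V E = {sum f V | f. is_sdrdf V E f}"

text \<open>The minimum is attained on every finite simple graph, see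
  \<open>finite_sdrdf_weights\<close> and \<open>sdrdf_weights_nonempty\<close>.\<close>

definition gamma_sdR :: "'a set \<Rightarrow> 'a set set \<Rightarrow> int" where
  "gamma_sdR V E = Min (sdrdf_weights V E)"

lemma finite_sdrdf_weights:
  assumes "finite V"
  shows "finite (sdrdf_weights V E)"
proof -
  have "sum f V \<in> {- int (card V) .. 3 * int (card V)}" if "is_sdrdf V E f" for f
  proof -
    have b: "-1 \<le> f u \<and> f u \<le> 3" if "u \<in> V" for u
      using \<open>is_sdrdf V E f\<close> that by (auto simp: is_sdrdf_def)
    have "sum f V \<le> int (card V) * 3"
      using sum_bounded_above[of V f 3] b by simp
    moreover have "int (card V) * (-1) \<le> sum f V"
      using sum_bounded_below[of V "-1" f] b by simp
    ultimately show ?thesis by simp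
  qed
  then have "sdrdf_weights V E \<subseteq> {- int (card V) .. 3 * int (card V)}"
    by (auto simp: sdrdf_weights_def)
  then show ?thesis
    using finite_subset by blast
qed

lemma sdrdf_weights_nonempty:
  assumes "simple_graph V E"
  shows "sdrdf_weights V E \<noteq> {}"
proof -
  have fin: "finite (closed_nbhd E u)" for u
  proof -
    have "open_nbhd E u \<subseteq> V"
      using assms by (auto simp: simple_graph_def open_nbhd_def)
    then show ?thesis
      using assms by (auto simp: simple_graph_def closed_nbhd_def intro: finite_subset)
  qed
  have "card (closed_nbhd E u) > 0" for u
    using fin[of u] by (simp add: card_gt_0_iff) (simp add: closed_nbhd_def)
  then have "1 \<le> 2 * int (card (closed_nbhd E u))" for u
    by (metis (no_types) Suc_le_eq mult_2 of_nat_1 of_nat_add of_nat_le_iff One_nat_def trans_le_add1)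
  then have "is_sdrdf V E (\<lambda>_. 2)"
    by (simp add: is_sdrdf_def mult.commute)
  then show ?thesis
    by (auto simp: sdrdf_weights_def)
qed

text \<open>\<open>Outer i\<close> and \<open>Inner i\<close> are the vertices \<open>u\<^sub>i\<close> and \<open>v\<^sub>i\<close>; residues modulo \<open>m\<close> are
  represented by the naturals below \<open>m\<close>.\<close>

datatype gp_vertex = Outer nat | Inner nat

definition gp_verts :: "nat \<Rightarrow> gp_vertex set" where
  "gp_verts m = Outer ` {..<m} \<union> Inner ` {..<m}"

definition gp_edges :: "nat \<Rightarrow> nat \<Rightarrow> gp_vertex set set" where
  "gp_edges m k =
     {{Outer i, Outer ((i + 1) mod m)} | i. i < m} \<union>
     {{Inner i, Inner ((i + k) mod m)} | i. i < m} \<union>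
     {{Outer i, Inner i} | i. i < m}"

lemma simple_graph_gp:
  assumes "m \<ge> 3" and "0 < k" and "k < m"
  shows "simple_graph (gp_verts m) (gp_edges m k)"
proof -
  have ne: "i \<noteq> (i + j) mod m" if "i < m" "0 < j" "j < m" for i j
    using that by (cases "i + j < m") (auto simp: mod_if)
  show ?thesis
    using assms ne[of _ 1] ne[of _ k]
    by (auto simp: simple_graph_def gp_verts_def gp_edges_def card_2_iff doubleton_eq_iff)
qed

end

theory Submission
  imports Defs
begin

text \<open>Lower bound, for any cubic graph on \<open>n\<close> vertices: let every positive vertex \<open>w\<close> send
  \<open>2 f(w) - 1\<close> to each of its negative neighbours. It has at most two of them, and every negative
  vertex receives at least 6, which rearranges to \<open>2 f(V) \<ge> n\<close>. In case of equality every vertex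
  has exactly one neighbour of its own sign, which forces \<open>4 dvd n\<close>; here \<open>n = 2 m\<close>.

  Upper bound: for even \<open>m\<close>, put 2 on both vertices of even index and -1 on both vertices of odd
  index. For odd \<open>m\<close>, insert a bounded defect into a pattern of period four.\<close>

section \<open>Cubic graphs\<close>

text \<open>Sending each vertex of \<open>A\<close> to its unique neighbour in \<open>A\<close> is
  an involution without fixed points, and its orbits partition \<open>A\<close> into pairs.\<close>

lemma even_card_perfect_matching:
  assumes "finite A" and "\<And>u. u \<in> A \<Longrightarrow> card (open_nbhd E u \<inter> A) = 1"
    and irrefl: "\<And>u. u \<in> A \<Longrightarrow> u \<notin> open_nbhd E u"
  shows "even (card A)"
proof -
  define s where "s u = the_elem (open_nbhd E u \<inter> A)" for u
  have s: "open_nbhd E u \<inter> A = {s u}" if "u \<in> A" for u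
    unfolding s_def using assms(2)[OF that] by (elim card_1_singletonE) simp
  have sA: "s u \<in> A" "s u \<in> open_nbhd E u" if "u \<in> A" for u
    using s[OF that] by auto
  have ss: "s (s u) = u" if "u \<in> A" for u
  proof -
    have "u \<in> open_nbhd E (s u) \<inter> A"
      using sA(2)[OF that] that by (simp add: open_nbhd_def insert_commute)
    then show ?thesis unfolding s[OF sA(1)[OF that]] by simp
  qed
  have ne: "s u \<noteq> u" if "u \<in> A" for u
    using sA(2)[OF that] irrefl[OF that] by auto
  let ?C = "(\<lambda>u. {u, s u}) ` A"
  have U: "\<Union>?C = A" using sA by auto
  have "2 dvd card (\<Union>?C)"
  proof (rule dvd_partition)
    show "finite (\<Union>?C)" using U assms(1) by simp
    show "\<forall>c\<in>?C. 2 dvd card c" using ne[symmetric] by auto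
    have "{u, s u} = {v, s v}" if uv: "u \<in> A" "v \<in> A" "{u, s u} \<inter> {v, s v} \<noteq> {}" for u v
    proof -
      have "u = v \<or> u = s v \<or> s u = v \<or> s u = s v" using uv(3) by auto
      then have "u = v \<or> u = s v" using ss[OF uv(1)] ss[OF uv(2)] by metis
      then show ?thesis using ss[OF uv(2)] by auto
    qed
    then show "\<forall>c1\<in>?C. \<forall>c2\<in>?C. c1 \<noteq> c2 \<longrightarrow> c1 \<inter> c2 = {}" by blast
  qed
  then show ?thesis using U by simp
qed

text \<open>\<open>x\<close>, \<open>y\<close>, \<open>z\<close> are the labels around a vertex
  labelled -1, whence the sum is at least 2. Among the admissible triples, total charge 6 occurs
  only for 2, 2, -1 and 3, 1, -1 in some order, each with a single -1.\<close>

lemma neg_vertex_arith: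
  fixes x y z :: int
  defines "g \<equiv> \<lambda>x. if x = -1 then 0 else 2 * x - 1"
    and "n \<equiv> \<lambda>x. if x = -1 then 1 else 0 :: nat"
  assumes "x \<in> {-1, 1, 2, 3}" "y \<in> {-1, 1, 2, 3}" "z \<in> {-1, 1, 2, 3}" "x + y + z \<ge> 2"
    and "x = 3 \<or> y = 3 \<or> z = 3 \<or> x = 2 \<and> y = 2 \<or> x = 2 \<and> z = 2 \<or> y = 2 \<and> z = 2"
  shows "g x + g y + g z \<ge> 6" and "g x + g y + g z = 6 \<Longrightarrow> n x + n y + n z = 1"
  using assms(3-) unfolding g_def n_def by (elim insertE emptyE; simp)+

locale cubic_sdrdf =
  fixes V :: "'a set" and E :: "'a set set" and f :: "'a \<Rightarrow> int"
  assumes finite_V: "finite V"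
    and nbhd_subset: "\<And>u. u \<in> V \<Longrightarrow> open_nbhd E u \<subseteq> V"
    and card_nbhd: "\<And>u. u \<in> V \<Longrightarrow> card (open_nbhd E u) = 3"
    and irrefl: "\<And>u. u \<in> V \<Longrightarrow> u \<notin> open_nbhd E u"
    and sdrdf: "is_sdrdf V E f"
begin

section \<open>Discharging from positive to negative vertices\<close>

definition Neg :: "'a set" where "Neg = {u \<in> V. f u = -1}"

text \<open>The value 0 on negative vertices lets sums of charges run over all neighbours instead of
  the positive ones only.\<close>

definition charge :: "'a \<Rightarrow> int" where "charge w = (if f w = -1 then 0 else 2 * f w - 1)"

lemma finite_Neg: "finite Neg" and Neg_subset: "Neg \<subseteq> V"
  using finite_V by (auto simp: Neg_def)

lemma f_range: "u \<in> V \<Longrightarrow> f u = -1 \<or> f u = 1 \<or> f u = 2 \<or> f u = 3"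
  using sdrdf by (auto simp: is_sdrdf_def)

lemma finite_nbhd: "u \<in> V \<Longrightarrow> finite (open_nbhd E u)"
  using nbhd_subset finite_V finite_subset by blast

lemma closed_nbhd_sum: "u \<in> V \<Longrightarrow> f u + sum f (open_nbhd E u) \<ge> 1"
  using sdrdf irrefl finite_nbhd by (auto simp: is_sdrdf_def closed_nbhd_def)

text \<open>Three neighbours labelled -1 would leave a closed neighbourhood sum of at most 3 - 3 =
  0.\<close>

lemma card_neg_nbrs_pos:
  assumes "u \<in> V" "u \<notin> Neg"
  shows "card (open_nbhd E u \<inter> Neg) \<le> 2"
proof (rule ccontr)
  assume "\<not> ?thesis"
  then have "card (open_nbhd E u) \<le> card (open_nbhd E u \<inter> Neg)"
    using card_nbhd[OF assms(1)] by simp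
  then have "open_nbhd E u \<inter> Neg = open_nbhd E u"
    using finite_nbhd[OF assms(1)] by (intro card_seteq) auto
  then have "sum f (open_nbhd E u) = (\<Sum>w\<in>open_nbhd E u. -1)"
    by (intro sum.cong) (auto simp: Neg_def)
  then have "sum f (open_nbhd E u) = -3"
    using card_nbhd[OF assms(1)] by simp
  then show False using closed_nbhd_sum[OF assms(1)] f_range[OF assms(1)] by auto
qed

lemma neg_received:
  assumes "u \<in> Neg"
  shows "sum charge (open_nbhd E u) \<ge> 6"
    and "sum charge (open_nbhd E u) = 6 \<Longrightarrow> card (open_nbhd E u \<inter> Neg) = 1"
proof -
  have u: "u \<in> V" "f u = -1" using assms by (auto simp: Neg_def)
  obtain a b c where N: "open_nbhd E u = {a, b, c}" and d: "a \<noteq> b" "a \<noteq> c" "b \<noteq> c"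
    using card_nbhd[OF u(1)] by (auto simp: card_3_iff)
  have V: "a \<in> V" "b \<in> V" "c \<in> V" using nbhd_subset[OF u(1)] N by auto
  have r: "f x \<in> {-1, 1, 2, 3}" if "x \<in> V" for x using f_range[OF that] by auto
  have S: "f a + f b + f c \<ge> 2" using closed_nbhd_sum[OF u(1)] N d u(2) by simp
  have D: "f a = 3 \<or> f b = 3 \<or> f c = 3 \<or> f a = 2 \<and> f b = 2 \<or> f a = 2 \<and> f c = 2 \<or> f b = 2 \<and> f c = 2"
  proof -
    have "(\<exists>w\<in>open_nbhd E u. f w = 3) \<or>
        (\<exists>w\<in>open_nbhd E u. \<exists>w'\<in>open_nbhd E u. w \<noteq> w' \<and> f w = 2 \<and> f w' = 2)"
      using sdrdf u unfolding is_sdrdf_def by blast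
    then show ?thesis unfolding N by auto
  qed
  have C: "sum charge (open_nbhd E u) = charge a + charge b + charge c"
    using N d by simp
  have I: "card (open_nbhd E u \<inter> Neg)
      = (if f a = -1 then 1 else 0) + (if f b = -1 then 1 else 0) + (if f c = -1 then 1 else 0)"
    using N d V by (auto simp: Neg_def Int_insert_left)
  note arith = neg_vertex_arith[OF r[OF V(1)] r[OF V(2)] r[OF V(3)] S D]
  show "sum charge (open_nbhd E u) \<ge> 6"
    unfolding C charge_def by (rule arith(1))
  show "card (open_nbhd E u \<inter> Neg) = 1" if "sum charge (open_nbhd E u) = 6"
    using that unfolding C I charge_def by (rule arith(2))
qed

text \<open>The weight \<open>h\<close> stays general: \<open>charge\<close> gives the discharging
  estimate, the constant 1 an edge count.\<close>

lemma double_count: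
  "(\<Sum>u\<in>Neg. sum h (open_nbhd E u)) = (\<Sum>w\<in>V. h w * int (card (open_nbhd E w \<inter> Neg)))"
proof -
  have "(\<Sum>u\<in>Neg. sum h (open_nbhd E u)) = (\<Sum>u\<in>Neg. \<Sum>w\<in>{w \<in> V. {u, w} \<in> E}. h w)"
    using nbhd_subset Neg_subset by (intro sum.cong) (auto simp: open_nbhd_def)
  also have "\<dots> = (\<Sum>w\<in>V. \<Sum>u\<in>{u \<in> Neg. {u, w} \<in> E}. h w)"
    by (rule sum.swap_restrict[OF finite_Neg finite_V])
  also have "\<dots> = (\<Sum>w\<in>V. h w * int (card (open_nbhd E w \<inter> Neg)))"
  proof (rule sum.cong)
    fix w
    have "{u \<in> Neg. {u, w} \<in> E} = open_nbhd E w \<inter> Neg"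
      by (auto simp: open_nbhd_def insert_commute)
    then show "(\<Sum>u\<in>{u \<in> Neg. {u, w} \<in> E}. h w) = h w * int (card (open_nbhd E w \<inter> Neg))"
      by simp
  qed simp
  finally show ?thesis .
qed

lemma charge_sent:
  assumes "w \<in> V"
  shows "charge w * int (card (open_nbhd E w \<inter> Neg)) \<le> 2 * charge w"
proof (cases "w \<in> Neg")
  case False
  then have "charge w \<ge> 0" using f_range[OF assms] by (auto simp: charge_def)
  then show ?thesis
    using card_neg_nbrs_pos[OF assms False] mult_left_mono[of "int (card (open_nbhd E w \<inter> Neg))" 2 "charge w"]
    by (simp add: mult.commute)
qed (auto simp: Neg_def charge_def)

lemma sum_charge: "sum charge V = 2 * sum f V - int (card V) + 3 * int (card Neg)"
proof -
  have "sum charge V = (\<Sum>w\<in>V. 2 * f w - 1 + (if f w = -1 then 3 else 0))"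
    by (intro sum.cong) (auto simp: charge_def)
  also have "\<dots> = 2 * sum f V - int (card V) + (\<Sum>w\<in>V. if f w = -1 then 3 else 0)"
    by (simp add: sum.distrib sum_subtractf sum_distrib_left)
  also have "(\<Sum>w\<in>V. if f w = -1 then 3 else 0) = 3 * int (card Neg)"
    using finite_V by (simp add: sum.If_cases Neg_def Int_def)
  finally show ?thesis .
qed

lemma received_le_sent:
  "(\<Sum>u\<in>Neg. sum charge (open_nbhd E u)) \<le> 2 * sum charge V"
  unfolding double_count sum_distrib_left by (intro sum_mono charge_sent)

text \<open>The negative vertices receive at least 6 each and at most
  \<open>2 * sum charge V\<close> together; after \<open>sum_charge\<close> the terms in
  \<open>card Neg\<close> cancel.\<close>

lemma weight_ge: "2 * sum f V \<ge> int (card V)"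
proof -
  have "6 * int (card Neg) \<le> (\<Sum>u\<in>Neg. sum charge (open_nbhd E u))"
    using sum_bounded_below[of Neg 6 "\<lambda>u. sum charge (open_nbhd E u)"] neg_received(1)
    by (simp add: mult.commute)
  then show ?thesis using received_le_sent sum_charge by linarith
qed

text \<open>In the extremal case every vertex has exactly one neighbour of its own sign. Hence half of
  all vertices are negative, and the negative vertices are perfectly matched.\<close>

lemma weight_eq_imp:
  assumes "2 * sum f V = int (card V)"
  shows "4 dvd card V"
proof -
  have lower: "(\<Sum>u\<in>Neg. 6) \<le> (\<Sum>u\<in>Neg. sum charge (open_nbhd E u))"
    by (intro sum_mono neg_received(1))
  \<comment> \<open>Equality makes \<open>sum charge V\<close> three times \<open>card Neg\<close>,
    so both bounds meet and every local inequality must be tight.\<close>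
  have upper: "(\<Sum>u\<in>Neg. sum charge (open_nbhd E u)) \<le> (\<Sum>u\<in>Neg. 6)"
    using received_le_sent sum_charge assms by simp
  have "(\<Sum>u\<in>Neg. sum charge (open_nbhd E u) - 6) = 0"
    using lower upper by (simp add: sum_subtractf)
  then have "\<forall>u\<in>Neg. sum charge (open_nbhd E u) - 6 = 0"
    using neg_received(1) finite_Neg by (subst (asm) sum_nonneg_eq_0_iff) auto
  then have one: "card (open_nbhd E u \<inter> Neg) = 1" if "u \<in> Neg" for u
    using neg_received(2) that by simp
  have "(\<Sum>w\<in>V. 2 * charge w - charge w * int (card (open_nbhd E w \<inter> Neg))) = 0"
    using lower sum_charge assms double_count[of charge] received_le_sent
    by (simp add: sum_subtractf flip: sum_distrib_left)
  then have tight: "\<forall>w\<in>V. 2 * charge w - charge w * int (card (open_nbhd E w \<inter> Neg)) = 0"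
    using charge_sent finite_V by (subst (asm) sum_nonneg_eq_0_iff) auto
  have two: "card (open_nbhd E w \<inter> Neg) = 2" if "w \<in> V - Neg" for w
  proof -
    have "charge w \<noteq> 0" using that f_range[of w] by (auto simp: charge_def Neg_def)
    moreover have "charge w * (2 - int (card (open_nbhd E w \<inter> Neg))) = 0"
      using tight that by (simp add: algebra_simps)
    ultimately show ?thesis by simp
  qed
  \<comment> \<open>Counting edge ends at \<open>Neg\<close> from both sides shows that exactly half
    of the vertices are negative.\<close>
  have "3 * int (card Neg) = (\<Sum>u\<in>Neg. \<Sum>w\<in>open_nbhd E u. 1)"
    using card_nbhd Neg_subset by (simp add: subset_iff)
  also have "\<dots> = (\<Sum>w\<in>V. int (card (open_nbhd E w \<inter> Neg)))"
    unfolding double_count by simp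
  also have "\<dots> = (\<Sum>w\<in>V - Neg. int (card (open_nbhd E w \<inter> Neg)))
      + (\<Sum>w\<in>Neg. int (card (open_nbhd E w \<inter> Neg)))"
    by (rule sum.subset_diff[OF Neg_subset finite_V])
  also have "\<dots> = 2 * int (card (V - Neg)) + int (card Neg)"
    using one two by simp
  finally have "card (V - Neg) = card Neg" by simp
  moreover have "card V = card (V - Neg) + card Neg"
    using card_Diff_subset[OF finite_Neg Neg_subset] card_mono[OF finite_V Neg_subset] by simp
  moreover have "even (card Neg)"
    using even_card_perfect_matching[OF finite_Neg one] irrefl Neg_subset by blast
  ultimately show ?thesis by (auto elim!: evenE)
qed

end

section \<open>The graph \<open>P\<^sub>m\<^sub>,\<^sub>3\<close>\<close>

text \<open>Solves for the backward neighbour; adding \<open>m - k\<close> replaces subtraction of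
  \<open>k\<close> modulo \<open>m\<close> on naturals.\<close>

lemma add_mod_eq_iff:
  fixes i j k m :: nat
  assumes "i < m" "0 < k" "k \<le> m"
  shows "j < m \<and> i = (j + k) mod m \<longleftrightarrow> j = (i + (m - k)) mod m"
proof -
  have "(j + k) mod m = (if j + k < m then j + k else j + k - m)" if "j < m"
    using assms that by (auto simp: mod_if)
  moreover have "(i + (m - k)) mod m = (if i + (m - k) < m then i + (m - k) else i + (m - k) - m)"
    using assms by (auto simp: mod_if)
  ultimately show ?thesis using assms by (cases "j < m") (auto split: if_splits)
qed

lemma open_nbhd_Outer:
  assumes "k < m" "0 < k" "i < m"
  shows "open_nbhd (gp_edges m k) (Outer i) = {Outer ((i + 1) mod m), Outer ((i + (m - 1)) mod m), Inner i}"
    (is "?L = ?R")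
proof (rule set_eqI)
  fix w
  show "w \<in> ?L \<longleftrightarrow> w \<in> ?R"
  proof (cases w)
    case (Outer j)
    have "{Outer i, Outer j} \<in> gp_edges m k \<longleftrightarrow> j = (i + 1) mod m \<or> (j < m \<and> i = (j + 1) mod m)"
      using assms by (auto simp: gp_edges_def doubleton_eq_iff)
    then show ?thesis
      using assms add_mod_eq_iff[of i m 1 j] by (simp add: open_nbhd_def Outer)
  next
    case (Inner j)
    then show ?thesis
      using assms by (auto simp: open_nbhd_def gp_edges_def doubleton_eq_iff)
  qed
qed

lemma open_nbhd_Inner:
  assumes "k < m" "0 < k" "i < m"
  shows "open_nbhd (gp_edges m k) (Inner i) = {Inner ((i + k) mod m), Inner ((i + (m - k)) mod m), Outer i}"
    (is "?L = ?R")
proof (rule set_eqI)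
  fix w
  show "w \<in> ?L \<longleftrightarrow> w \<in> ?R"
  proof (cases w)
    case (Inner j)
    have "{Inner i, Inner j} \<in> gp_edges m k \<longleftrightarrow> j = (i + k) mod m \<or> (j < m \<and> i = (j + k) mod m)"
      using assms by (auto simp: gp_edges_def doubleton_eq_iff)
    then show ?thesis
      using assms add_mod_eq_iff[of i m k j] by (simp add: open_nbhd_def Inner)
  next
    case (Outer j)
    then show ?thesis
      using assms by (auto simp: open_nbhd_def gp_edges_def doubleton_eq_iff)
  qed
qed

text \<open>The bound \<open>2 * k < m\<close> keeps the forward and backward neighbours apart, so
  every vertex has degree three.\<close>

lemma add_mod_neq:
  fixes i k m :: nat
  assumes "i < m" "0 < k" "2 * k < m"
  shows "(i + k) mod m \<noteq> i" "(i + (m - k)) mod m \<noteq> i" "(i + k) mod m \<noteq> (i + (m - k)) mod m"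
  using assms by (auto simp: mod_if)

lemma gp_verts_ball:
  "(\<forall>u\<in>gp_verts m. P u) \<longleftrightarrow> (\<forall>i<m. P (Outer i) \<and> P (Inner i))"
  by (auto simp: gp_verts_def)

lemma sum_gp_verts: "sum f (gp_verts m) = (\<Sum>i<m. f (Outer i) + f (Inner i))"
  unfolding gp_verts_def
  by (subst sum.union_disjoint) (auto simp: sum.reindex inj_on_def sum.distrib)

lemma card_gp_verts: "card (gp_verts m) = 2 * m"
  unfolding gp_verts_def
  by (subst card_Un_disjoint) (auto simp: card_image inj_on_def)

lemma cubic_sdrdf_gp:
  assumes "0 < k" "2 * k < m" "2 < m" "is_sdrdf (gp_verts m) (gp_edges m k) f"
  shows "cubic_sdrdf (gp_verts m) (gp_edges m k) f"
proof
  show "finite (gp_verts m)" by (simp add: gp_verts_def)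
  have *: "\<forall>u\<in>gp_verts m. open_nbhd (gp_edges m k) u \<subseteq> gp_verts m \<and>
      card (open_nbhd (gp_edges m k) u) = 3 \<and> u \<notin> open_nbhd (gp_edges m k) u"
    unfolding gp_verts_ball
  proof (intro allI impI)
    fix i assume i: "i < m"
    define a b c d where abcd: "a = (i + 1) mod m" "b = (i + (m - 1)) mod m"
      "c = (i + k) mod m" "d = (i + (m - k)) mod m"
    have ne: "a \<noteq> i" "b \<noteq> i" "a \<noteq> b" "c \<noteq> i" "d \<noteq> i" "c \<noteq> d"
      unfolding abcd by (rule add_mod_neq; use i assms(1-3) in simp)+
    have lt: "a < m" "b < m" "c < m" "d < m" using assms(1-3) unfolding abcd by simp_all
    have N: "open_nbhd (gp_edges m k) (Outer i) = {Outer a, Outer b, Inner i}"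
      "open_nbhd (gp_edges m k) (Inner i) = {Inner c, Inner d, Outer i}"
      unfolding abcd by (rule open_nbhd_Outer open_nbhd_Inner; use i assms(1-3) in simp)+
    show "(open_nbhd (gp_edges m k) (Outer i) \<subseteq> gp_verts m \<and>
        card (open_nbhd (gp_edges m k) (Outer i)) = 3 \<and> Outer i \<notin> open_nbhd (gp_edges m k) (Outer i)) \<and>
      (open_nbhd (gp_edges m k) (Inner i) \<subseteq> gp_verts m \<and>
        card (open_nbhd (gp_edges m k) (Inner i)) = 3 \<and> Inner i \<notin> open_nbhd (gp_edges m k) (Inner i))"
      using i lt ne ne[symmetric] unfolding N gp_verts_def by auto
  qed
  show "open_nbhd (gp_edges m k) u \<subseteq> gp_verts m" "card (open_nbhd (gp_edges m k) u) = 3"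
    "u \<notin> open_nbhd (gp_edges m k) u" if "u \<in> gp_verts m" for u
    using * that by auto
qed fact

text \<open>With \<open>2 * m\<close> vertices, weight \<open>m\<close> would force 4 to divide
  \<open>2 * m\<close>; for odd \<open>m\<close> integrality then gains one.\<close>

lemma gp_weight_ge:
  assumes "0 < k" "2 * k < m" "2 < m" "is_sdrdf (gp_verts m) (gp_edges m k) f"
  shows "sum f (gp_verts m) \<ge> (if even m then int m else int m + 1)"
proof -
  interpret cubic_sdrdf "gp_verts m" "gp_edges m k" f
    by (rule cubic_sdrdf_gp[OF assms])
  have "sum f (gp_verts m) \<ge> int m" using weight_ge by (simp add: card_gp_verts)
  moreover have "even m" if "sum f (gp_verts m) = int m"
    using weight_eq_imp that by (auto simp: card_gp_verts)
  ultimately show ?thesis by (cases "sum f (gp_verts m) = int m") auto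
qed

section \<open>Labellings as cyclic words of columns\<close>

text \<open>The conditions at a vertex labelled \<open>x\<close>, where \<open>a\<close>,
  \<open>b\<close>, \<open>c\<close> are the labels of three distinct neighbours.\<close>

definition vertex_ok :: "int \<Rightarrow> int \<Rightarrow> int \<Rightarrow> int \<Rightarrow> bool" where
  "vertex_ok x a b c \<longleftrightarrow> x \<in> {-1, 1, 2, 3} \<and>
     (x = -1 \<longrightarrow> a = 3 \<or> b = 3 \<or> c = 3 \<or> a = 2 \<and> b = 2 \<or> a = 2 \<and> c = 2 \<or> b = 2 \<and> c = 2) \<and>
     (x = 1 \<longrightarrow> a \<in> {2, 3} \<or> b \<in> {2, 3} \<or> c \<in> {2, 3}) \<and> x + a + b + c \<ge> 1"

text \<open>A column is a pair of labels \<open>(f u\<^sub>i, f v\<^sub>i)\<close>. The neighbours of both vertices of a column lie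
  in the window of seven columns around it.\<close>

fun windows_ok :: "(int \<times> int) list \<Rightarrow> bool" where
  "windows_ok (x0 # x1 # x2 # x3 # x4 # x5 # x6 # xs) \<longleftrightarrow>
     vertex_ok (fst x3) (fst x4) (fst x2) (snd x3) \<and>
     vertex_ok (snd x3) (snd x6) (snd x0) (fst x3) \<and>
     windows_ok (x1 # x2 # x3 # x4 # x5 # x6 # xs)"
| "windows_ok xs \<longleftrightarrow> True"

lemma windows_ok_nth:
  assumes "windows_ok xs" "j + 6 < length xs"
  shows "vertex_ok (fst (xs ! (j + 3))) (fst (xs ! (j + 4))) (fst (xs ! (j + 2))) (snd (xs ! (j + 3))) \<and>
    vertex_ok (snd (xs ! (j + 3))) (snd (xs ! (j + 6))) (snd (xs ! j)) (fst (xs ! (j + 3)))"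
  using assms
proof (induction xs arbitrary: j rule: windows_ok.induct)
  case (1 x0 x1 x2 x3 x4 x5 x6 xs)
  show ?case
  proof (cases j)
    case 0
    then show ?thesis using 1(2) by (simp add: numeral_eq_Suc)
  next
    case (Suc i)
    then show ?thesis using 1(1)[of i] 1(2,3) by (simp add: numeral_eq_Suc)
  qed
qed auto

text \<open>Repeating the first six columns at the end turns each of the \<open>m\<close> cyclic
  windows into a linear one.\<close>

lemma windows_ok_cyclic:
  assumes ok: "windows_ok (w @ take 6 w)" and len: "length w = m" "6 < m" and i: "i < m"
  shows "vertex_ok (fst (w ! i)) (fst (w ! ((i + 1) mod m))) (fst (w ! ((i + (m - 1)) mod m))) (snd (w ! i))"
    and "vertex_ok (snd (w ! i)) (snd (w ! ((i + 3) mod m))) (snd (w ! ((i + (m - 3)) mod m))) (fst (w ! i))"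
proof -
  \<comment> \<open>The window centred at column \<open>i\<close> starts three columns
    earlier.\<close>
  define j where "j = (i + (m - 3)) mod m"
  have j: "j < m" using len by (simp add: j_def)
  have nth: "(w @ take 6 w) ! (j + l) = w ! ((j + l) mod m)" if "l \<le> 6" for l
  proof (cases "j + l < m")
    case True
    then show ?thesis using len by (simp add: nth_append)
  next
    case False
    then have "j + l - m < 6" "(j + l) mod m = j + l - m" using that j len by (simp_all add: le_mod_geq)
    then show ?thesis using False len by (simp add: nth_append)
  qed
  have jl: "(j + l) mod m = (i + (m - 3 + l)) mod m" for l
    by (simp add: j_def mod_add_left_eq add.assoc)
  have "m - 3 + 3 = m" "m - 3 + 4 = 1 + m" "m - 3 + 2 = m - 1" "m - 3 + 6 = 3 + m"
    using len by simp_all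
  then have m: "(j + 3) mod m = i" "(j + 4) mod m = (i + 1) mod m" "(j + 2) mod m = (i + (m - 1)) mod m"
      "(j + 6) mod m = (i + 3) mod m" "j mod m = (i + (m - 3)) mod m"
    using i by (simp_all only: jl add.assoc[symmetric] mod_add_self2 mod_less) (simp add: j_def)
  note * = windows_ok_nth[OF ok, of j]
  show "vertex_ok (fst (w ! i)) (fst (w ! ((i + 1) mod m))) (fst (w ! ((i + (m - 1)) mod m))) (snd (w ! i))"
    "vertex_ok (snd (w ! i)) (snd (w ! ((i + 3) mod m))) (snd (w ! ((i + (m - 3)) mod m))) (fst (w ! i))"
    using * nth[of 3, unfolded m] nth[of 4, unfolded m] nth[of 2, unfolded m] nth[of 6, unfolded m]
      nth[of 0, unfolded add_0_right m] j len by (simp_all del: add_2_eq_Suc')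
qed

lemma sdrdf_of_word:
  assumes ok: "windows_ok (w @ take 6 w)" and len: "length w = m" "6 < m"
  shows "sum_list (map (\<lambda>c. fst c + snd c) w) \<in> sdrdf_weights (gp_verts m) (gp_edges m 3)"
proof -
  define f where "f v = (case v of Outer i \<Rightarrow> fst (w ! i) | Inner i \<Rightarrow> snd (w ! i))" for v
  have N: "open_nbhd (gp_edges m 3) (Outer i) = {Outer ((i + 1) mod m), Outer ((i + (m - 1)) mod m), Inner i}"
    "open_nbhd (gp_edges m 3) (Inner i) = {Inner ((i + 3) mod m), Inner ((i + (m - 3)) mod m), Outer i}"
    if "i < m" for i
    using open_nbhd_Outer[of 3 m i] open_nbhd_Inner[of 3 m i] len that by simp_all
  have "is_sdrdf (gp_verts m) (gp_edges m 3) f"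
    unfolding is_sdrdf_def gp_verts_ball
  proof (intro conjI allI impI)
    fix i assume i: "i < m"
    define a b c d where abcd: "a = (i + 1) mod m" "b = (i + (m - 1)) mod m"
      "c = (i + 3) mod m" "d = (i + (m - 3)) mod m"
    have ne: "a \<noteq> i" "b \<noteq> i" "a \<noteq> b" "c \<noteq> i" "d \<noteq> i" "c \<noteq> d"
      unfolding abcd by (rule add_mod_neq; use i len in simp)+
    note v = windows_ok_cyclic[OF ok len i, folded abcd, unfolded vertex_ok_def]
    note N' = N[OF i, folded abcd]
    show "f (Outer i) \<in> {-1, 1, 2, 3}" "f (Inner i) \<in> {-1, 1, 2, 3}"
      using v by (simp_all add: f_def)
    show "1 \<le> sum f (closed_nbhd (gp_edges m 3) (Outer i))"
      "1 \<le> sum f (closed_nbhd (gp_edges m 3) (Inner i))"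
      using v ne ne[symmetric] by (simp_all add: closed_nbhd_def N' f_def add.assoc)
    {
      assume "f (Outer i) = -1"
      then show "(\<exists>w\<in>open_nbhd (gp_edges m 3) (Outer i). f w = 3) \<or>
        (\<exists>w\<in>open_nbhd (gp_edges m 3) (Outer i). \<exists>w'\<in>open_nbhd (gp_edges m 3) (Outer i).
          w \<noteq> w' \<and> f w = 2 \<and> f w' = 2)"
        using v(1) ne unfolding N' by (auto simp: f_def)
    next
      assume "f (Inner i) = -1"
      then show "(\<exists>w\<in>open_nbhd (gp_edges m 3) (Inner i). f w = 3) \<or>
        (\<exists>w\<in>open_nbhd (gp_edges m 3) (Inner i). \<exists>w'\<in>open_nbhd (gp_edges m 3) (Inner i).
          w \<noteq> w' \<and> f w = 2 \<and> f w' = 2)"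
        using v(2) ne unfolding N' by (auto simp: f_def)
    next
      assume "f (Outer i) = 1"
      then show "\<exists>w\<in>open_nbhd (gp_edges m 3) (Outer i). f w = 2 \<or> f w = 3"
        using v(1) unfolding N' by (auto simp: f_def)
    next
      assume "f (Inner i) = 1"
      then show "\<exists>w\<in>open_nbhd (gp_edges m 3) (Inner i). f w = 2 \<or> f w = 3"
        using v(2) unfolding N' by (auto simp: f_def)
    }
  qed
  moreover have "sum f (gp_verts m) = sum_list (map (\<lambda>c. fst c + snd c) w)"
    using len by (simp add: sum_gp_verts f_def sum_list_sum_nth atLeast0LessThan)
  ultimately show ?thesis unfolding sdrdf_weights_def by (metis (mono_tags, lifting) mem_Collect_eq)
qed

section \<open>Pumping periodic words\<close>

definition blocks :: "'a list \<Rightarrow> nat \<Rightarrow> 'a list" where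
  "blocks b k = concat (replicate k b)"

lemma blocks_simps [simp]: "blocks b 0 = []" "blocks b (Suc k) = b @ blocks b k"
  by (simp_all add: blocks_def)

lemma length_blocks: "length (blocks b k) = k * length b"
  by (induction k) simp_all

lemma sum_list_blocks: "sum_list (map g (blocks b k)) = of_nat k * sum_list (map g b)"
  for g :: "'a \<Rightarrow> 'b :: semiring_1"
  by (induction k) (simp_all add: algebra_simps)

text \<open>A window meeting both \<open>xs\<close> and \<open>ys\<close> would contain all of
  \<open>p\<close> and so have at least eight columns; hence every window lies in
  \<open>xs @ p\<close> or in \<open>p @ ys\<close>.\<close>

lemma windows_ok_append:
  assumes "windows_ok (xs @ p)" "windows_ok (p @ ys)" "length p = 6"
  shows "windows_ok (xs @ p @ ys)"
  using assms(1)
proof (induction xs)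
  case Nil
  then show ?case using assms(2) by simp
next
  case (Cons x xs)
  obtain p1 p2 p3 p4 p5 p6 where p: "p = [p1, p2, p3, p4, p5, p6]"
    using assms(3) by (auto simp: length_Suc_conv numeral_eq_Suc)
  obtain y1 y2 y3 y4 y5 y6 r where xp: "xs @ p = y1 # y2 # y3 # y4 # y5 # y6 # r"
    by (cases "xs @ p" rule: windows_ok.cases) (use p in auto)
  then have xpy: "xs @ p @ ys = y1 # y2 # y3 # y4 # y5 # y6 # r @ ys"
    by (metis append.assoc append_Cons)
  show ?case using Cons unfolding append_Cons xp xpy by simp
qed

text \<open>Words starting with the prefix \<open>p\<close> of the periodic pattern \<open>b\<^sup>\<omega>\<close> can be pumped.\<close>

lemma windows_ok_pump:
  assumes "windows_ok (b @ p)" "length p = 6" "b @ p = p @ q" "windows_ok (p @ t)"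
  shows "\<exists>t'. blocks b k @ p @ t = p @ t' \<and> windows_ok (p @ t')"
proof (induction k)
  case 0
  then show ?case using assms(4) by auto
next
  case (Suc k)
  then obtain t' where t': "blocks b k @ p @ t = p @ t'" "windows_ok (p @ t')" by blast
  \<comment> \<open>The identity \<open>b @ p = p @ q\<close> moves the prefix to the front past the
    new block.\<close>
  have "blocks b (Suc k) @ p @ t = p @ q @ t'"
    using t'(1) assms(3) by (metis append.assoc blocks_simps(2))
  moreover have "windows_ok (p @ q @ t')"
    using windows_ok_append[OF assms(1) t'(2) assms(2)] assms(3) by (metis append.assoc)
  ultimately show ?case by blast
qed

text \<open>The pumped word still starts with \<open>p\<close>, so closing it cyclically appends
  \<open>p\<close> again. Hence the single check of \<open>p @ t @ p\<close> covers all
  \<open>k\<close>.\<close>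

lemma sdrdf_weights_pump:
  assumes "windows_ok (b @ p)" "length p = 6" "b @ p = p @ q" "windows_ok (p @ t @ p)"
    and "k * length b + length t = n" "0 < n"
    and "int k * sum_list (map (\<lambda>c. fst c + snd c) b) + sum_list (map (\<lambda>c. fst c + snd c) (p @ t)) = s"
  shows "s \<in> sdrdf_weights (gp_verts (6 + n)) (gp_edges (6 + n) 3)"
proof -
  let ?w = "blocks b k @ p @ t"
  obtain t' where t': "blocks b k @ p @ t @ p = p @ t'" "windows_ok (p @ t')"
    using windows_ok_pump[OF assms(1-4)] by blast
  have "take 6 (?w @ p) = p" using t'(1) assms(2) by simp
  then have "take 6 ?w = p" using assms(2) by (simp add: take_append)
  then have "windows_ok (?w @ take 6 ?w)" using t' by simp
  moreover have "length ?w = 6 + n" using assms(2,5) by (simp add: length_blocks)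
  ultimately have "sum_list (map (\<lambda>c. fst c + snd c) ?w) \<in> sdrdf_weights (gp_verts (6 + n)) (gp_edges (6 + n) 3)"
    using assms(6) by (intro sdrdf_of_word) auto
  then show ?thesis using assms(7) by (simp add: sum_list_blocks)
qed

section \<open>Words attaining the lower bounds\<close>

lemma weight_even_attained:
  assumes "even m" "m \<ge> 8"
  shows "int m \<in> sdrdf_weights (gp_verts m) (gp_edges m 3)"
proof -
  from assms obtain k where "m = 2 * k" "k \<ge> 4" by (auto elim!: evenE)
  then obtain k where k: "m = 6 + (2 * k + 2)" using nat_le_iff_add[of 4] by auto
  \<comment> \<open>The columns weigh 4 and -2, one per column on average. Three blocks form
    \<open>p\<close> and a fourth serves as \<open>t\<close>, so \<open>k = 0\<close> is the case
    \<open>m = 8\<close>.\<close>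
  define b p :: "(int \<times> int) list" where "b = [(2, 2), (-1, -1)]" and "p = b @ b @ b"
  show ?thesis unfolding k
    by (rule sdrdf_weights_pump[where b = b and p = p and q = b and t = b and k = k])
      (simp_all add: b_def p_def vertex_ok_def)
qed

text \<open>The defects \<open>d1\<close> and \<open>d3\<close>, one for each odd residue of \<open>m\<close> modulo 4, were found by computer
  search. For \<open>m = 11\<close> the length 8 of \<open>d3\<close> leaves no room for a full prefix \<open>p\<close>.\<close>

lemma weight_odd_attained:
  assumes "odd m" "m \<ge> 9"
  shows "int m + 1 \<in> sdrdf_weights (gp_verts m) (gp_edges m 3)"
proof -
  \<comment> \<open>Every column of \<open>b\<close> has weight 1, while \<open>d1\<close> has
    weight 4 on 3 columns and \<open>d3\<close> weight 9 on 8, which accounts for the excess of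
    one.\<close>
  define b p :: "(int \<times> int) list"
    where "b = [(-1, 2), (-1, 2), (2, -1), (2, -1)]" and "p = b @ [(-1, 2), (-1, 2)]"
  define d1 d3 :: "(int \<times> int) list"
    where "d1 = [(2, 1), (-1, -1), (2, 1)]"
      and "d3 = [(1, -1), (-1, 3), (-1, 2), (2, 2), (-1, -1), (2, 1), (-1, -1), (2, 1)]"
  have "m mod 4 = 1 \<or> m mod 4 = 3" using assms(1) by presburger
  then consider k where "m = 6 + (k * 4 + 3)" | "m = 11" | k where "m = 6 + (k * 4 + 9)"
  proof
    assume "m mod 4 = 1"
    then have "m = 6 + ((m div 4 - 2) * 4 + 3)" using assms(2) by presburger
    then show ?thesis using that by blast
  next
    assume "m mod 4 = 3"
    then have "m = 11 \<or> m = 6 + ((m div 4 - 3) * 4 + 9)" using assms(2) by presburger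
    then show ?thesis using that by blast
  qed
  then show ?thesis
  proof cases
    case (1 k)
    show ?thesis unfolding 1
      by (rule sdrdf_weights_pump[where b = b and p = p and q = "drop 2 p" and t = d1 and k = k])
        (simp_all add: b_def p_def d1_def vertex_ok_def)
  next
    case 2
    \<comment> \<open>The word for \<open>m = 15\<close> with one block \<open>b\<close> removed
      from its front.\<close>
    let ?w = "[(-1, 2), (-1, 2), (2, -1)] @ d3"
    have "sum_list (map (\<lambda>c. fst c + snd c) ?w) \<in> sdrdf_weights (gp_verts m) (gp_edges m 3)"
      using 2 by (intro sdrdf_of_word) (simp_all add: d3_def vertex_ok_def)
    then show ?thesis using 2 by (simp add: d3_def)
  next
    case (3 k)
    show ?thesis unfolding 3
      by (rule sdrdf_weights_pump[where b = b and p = p and q = "drop 2 p" and t = "(2, -1) # d3" and k = k])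
        (simp_all add: b_def p_def d3_def vertex_ok_def)
  qed
qed

theorem theorem5:
  fixes m :: nat
  assumes "m \<ge> 8"
  shows "gamma_sdR (gp_verts m) (gp_edges m 3) = (if even m then int m else int m + 1)"
  unfolding gamma_sdR_def
proof (rule Min_eqI)
  show "finite (sdrdf_weights (gp_verts m) (gp_edges m 3))"
    by (rule finite_sdrdf_weights) (simp add: gp_verts_def)
  show "(if even m then int m else int m + 1) \<in> sdrdf_weights (gp_verts m) (gp_edges m 3)"
  proof (cases "even m")
    case False
    then have "m \<noteq> 8" by auto
    then show ?thesis using False assms weight_odd_attained[of m] by simp
  qed (use assms weight_even_attained[of m] in simp)
  show "(if even m then int m else int m + 1) \<le> s"
    if "s \<in> sdrdf_weights (gp_verts m) (gp_edges m 3)" for s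
    using that gp_weight_ge[of 3 m] assms by (auto simp: sdrdf_weights_def)
qed

end
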